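(* For each $n\ge 3$ the group $\mathbb{T}_n$ is generated by $t_{ij}$, $1\le i<j\le n$, and $t_{i1}$, $i=2,\dots,n$, subject to the (defining) relations $$t_{i1}t_{j1}^{-1}t_{jk}t_{1k}^{-1}t_{1j}t_{ij}^{-1}t_{ik}=t_{ik}t_{1k}^{-1}t_{1j}t_{ij}^{-1}t_{i1}t_{j1}^{-1}t_{jk}$$ for all $2\le i<j<k\le n$.
   Context: $[n]=\{1,\dots,n\}$. The big triangle group $\mathbb{T}_n$ of the $n$-gon is the group generated by $t_{ij}$, $i,j\in[n]$, $i\ne j$, subject to the triangle relations $t_{ij}t_{kj}^{-1}t_{ki}=t_{ik}t_{jk}^{-1}t_{ji}$ for all distinct $i,j,k\in[n]$. *)

theory Defs
  imports "HOL-Algebra.Coset"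
begin

section \<open>Free groups\<close>

text \<open>A letter \<open>(x, True)\<close> stands for the generator \<open>x\<close>, a letter \<open>(x, False)\<close> for its inverse.
  The elements of the free group are the freely reduced words.\<close>

definition inv_letter :: "'a \<times> bool \<Rightarrow> 'a \<times> bool" where
  "inv_letter a = (fst a, \<not> snd a)"

fun reduced :: "('a \<times> bool) list \<Rightarrow> bool" where
  "reduced (a # b # w) \<longleftrightarrow> b \<noteq> inv_letter a \<and> reduced (b # w)"
| "reduced w \<longleftrightarrow> True"

fun push :: "'a \<times> bool \<Rightarrow> ('a \<times> bool) list \<Rightarrow> ('a \<times> bool) list" where
  "push a [] = [a]"
| "push a (b # w) = (if b = inv_letter a then w else a # b # w)"

definition free_group :: "'a set \<Rightarrow> ('a \<times> bool) list monoid" where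
  "free_group X = \<lparr>carrier = {w. reduced w \<and> fst ` set w \<subseteq> X},
                   monoid.mult = (\<lambda>u v. foldr push u v), one = []\<rparr>"

definition free_gen :: "'a \<Rightarrow> ('a \<times> bool) list" where
  "free_gen x = [(x, True)]"

lemma inv_letter_simps [simp]:
  "inv_letter (inv_letter a) = a" "fst (inv_letter a) = fst a"
  "inv_letter a \<noteq> a" "a \<noteq> inv_letter a"
  by (cases a; auto simp: inv_letter_def)+

lemma reduced_ConsD: "reduced (a # w) \<Longrightarrow> reduced w"
  by (cases w) auto

lemma reduced_push: "reduced w \<Longrightarrow> reduced (push a w)"
  by (cases w) (auto dest: reduced_ConsD)

lemma reduced_foldr_push: "reduced v \<Longrightarrow> reduced (foldr push u v)"
  by (induction u) (auto intro: reduced_push)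

lemma set_push: "set (push a w) \<subseteq> insert a (set w)"
  by (cases w) auto

lemma set_foldr_push: "set (foldr push u v) \<subseteq> set u \<union> set v"
  by (induction u) (use set_push in fastforce)+

lemma push_inv_letter: "reduced w \<Longrightarrow> push a (push (inv_letter a) w) = w"
proof (cases w)
  case (Cons b v)
  then show "reduced w \<Longrightarrow> ?thesis" by (cases v) auto
qed simp

lemma foldr_push_push:
  assumes "reduced v" "reduced w"
  shows "foldr push (push a v) w = push a (foldr push v w)"
proof (cases v)
  case (Cons b v')
  with assms show ?thesis
    using push_inv_letter[of "foldr push v' w" a] by (auto simp: reduced_foldr_push)
qed simp

lemma foldr_push_assoc:
  assumes "reduced v" "reduced w"
  shows "foldr push (foldr push u v) w = foldr push u (foldr push v w)"
  by (induction u) (use assms in \<open>auto simp: foldr_push_push reduced_foldr_push\<close>)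

lemma foldr_push_Nil: "reduced w \<Longrightarrow> foldr push w [] = w"
proof (induction w)
  case (Cons a w)
  then show ?case by (cases w) (auto dest: reduced_ConsD)
qed simp

lemma foldr_push_rev_inv: "reduced v \<Longrightarrow> foldr push (rev (map inv_letter u)) (foldr push u v) = v"
proof (induction u arbitrary: v)
  case (Cons a u)
  then show ?case
    using push_inv_letter[of "foldr push u v" "inv_letter a"] by (simp add: reduced_foldr_push)
qed simp

lemma group_free_group: "group (free_group X)"
proof (rule groupI)
  fix u assume u: "u \<in> carrier (free_group X)"
  let ?v = "foldr push (rev (map inv_letter u)) []"
  have "foldr push ?v u = foldr push (rev (map inv_letter u)) (foldr push u [])"
    using u foldr_push_assoc[of "[]" u "rev (map inv_letter u)"]
    by (simp add: free_group_def foldr_push_Nil)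
  then have "?v \<otimes>\<^bsub>free_group X\<^esub> u = \<one>\<^bsub>free_group X\<^esub>"
    by (simp add: foldr_push_rev_inv free_group_def)
  moreover have "?v \<in> carrier (free_group X)"
    using u set_foldr_push[of "rev (map inv_letter u)" "[]"]
    by (fastforce simp: free_group_def intro: reduced_foldr_push)
  ultimately show "\<exists>v \<in> carrier (free_group X). v \<otimes>\<^bsub>free_group X\<^esub> u = \<one>\<^bsub>free_group X\<^esub>"
    by blast
next
  fix u v assume "u \<in> carrier (free_group X)" "v \<in> carrier (free_group X)"
  then show "u \<otimes>\<^bsub>free_group X\<^esub> v \<in> carrier (free_group X)"
    using set_foldr_push[of u v] by (fastforce simp: free_group_def intro: reduced_foldr_push)
qed (auto simp: free_group_def foldr_push_assoc)


section \<open>Presentations by generators and relations\<close>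

definition normal_closure :: "('g, 'm) monoid_scheme \<Rightarrow> 'g set \<Rightarrow> 'g set" where
  "normal_closure G S = \<Inter>{N. N \<lhd> G \<and> S \<subseteq> N}"

text \<open>A pair \<open>(u, v)\<close> in \<open>E\<close> is the relation \<open>u = v\<close> between two elements of the free group on \<open>X\<close>.\<close>

definition relator_subgroup ::
  "'a set \<Rightarrow> (('a \<times> bool) list \<times> ('a \<times> bool) list) set \<Rightarrow> ('a \<times> bool) list set" where
  "relator_subgroup X E =
     normal_closure (free_group X) {u \<otimes>\<^bsub>free_group X\<^esub> inv\<^bsub>free_group X\<^esub> v | u v. (u, v) \<in> E}"

definition presented_group ::
  "'a set \<Rightarrow> (('a \<times> bool) list \<times> ('a \<times> bool) list) set \<Rightarrow> ('a \<times> bool) list set monoid" where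
  "presented_group X E = free_group X Mod relator_subgroup X E"

definition presented_gen ::
  "'a set \<Rightarrow> (('a \<times> bool) list \<times> ('a \<times> bool) list) set \<Rightarrow> 'a \<Rightarrow> ('a \<times> bool) list set" where
  "presented_gen X E x = relator_subgroup X E #>\<^bsub>free_group X\<^esub> free_gen x"


section \<open>The big triangle group\<close>

definition triangle_gens :: "nat \<Rightarrow> (nat \<times> nat) set" where
  "triangle_gens n = {(i, j). i \<in> {1..n} \<and> j \<in> {1..n} \<and> i \<noteq> j}"

definition triangle_rels ::
  "nat \<Rightarrow> (((nat \<times> nat) \<times> bool) list \<times> ((nat \<times> nat) \<times> bool) list) set" where
  "triangle_rels n =
     (let F = free_group (triangle_gens n); t = (\<lambda>i j. free_gen (i, j)) in
      {(t i j \<otimes>\<^bsub>F\<^esub> inv\<^bsub>F\<^esub> t k j \<otimes>\<^bsub>F\<^esub> t k i,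
        t i k \<otimes>\<^bsub>F\<^esub> inv\<^bsub>F\<^esub> t j k \<otimes>\<^bsub>F\<^esub> t j i) | i j k.
        i \<in> {1..n} \<and> j \<in> {1..n} \<and> k \<in> {1..n} \<and> i \<noteq> j \<and> j \<noteq> k \<and> i \<noteq> k})"

definition big_triangle_group :: "nat \<Rightarrow> ((nat \<times> nat) \<times> bool) list set monoid" where
  "big_triangle_group n = presented_group (triangle_gens n) (triangle_rels n)"

definition big_triangle_gen :: "nat \<Rightarrow> nat \<times> nat \<Rightarrow> ((nat \<times> nat) \<times> bool) list set" where
  "big_triangle_gen n = presented_gen (triangle_gens n) (triangle_rels n)"


section \<open>The smaller presentation\<close>

definition small_gens :: "nat \<Rightarrow> (nat \<times> nat) set" where
  "small_gens n = {(i, j). 1 \<le> i \<and> i < j \<and> j \<le> n} \<union> {(i, 1) | i. 2 \<le> i \<and> i \<le> n}"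

definition small_rels ::
  "nat \<Rightarrow> (((nat \<times> nat) \<times> bool) list \<times> ((nat \<times> nat) \<times> bool) list) set" where
  "small_rels n =
     (let F = free_group (small_gens n); t = (\<lambda>i j. free_gen (i, j)) in
      {(t i 1 \<otimes>\<^bsub>F\<^esub> inv\<^bsub>F\<^esub> t j 1 \<otimes>\<^bsub>F\<^esub> t j k \<otimes>\<^bsub>F\<^esub> inv\<^bsub>F\<^esub> t 1 k \<otimes>\<^bsub>F\<^esub> t 1 j \<otimes>\<^bsub>F\<^esub> inv\<^bsub>F\<^esub> t i j \<otimes>\<^bsub>F\<^esub> t i k,
        t i k \<otimes>\<^bsub>F\<^esub> inv\<^bsub>F\<^esub> t 1 k \<otimes>\<^bsub>F\<^esub> t 1 j \<otimes>\<^bsub>F\<^esub> inv\<^bsub>F\<^esub> t i j \<otimes>\<^bsub>F\<^esub> t i 1 \<otimes>\<^bsub>F\<^esub> inv\<^bsub>F\<^esub> t j 1 \<otimes>\<^bsub>F\<^esub> t j k) | i j k.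
        2 \<le> i \<and> i < j \<and> j < k \<and> k \<le> n})"

end

theory Submission
  imports Defs
begin

text \<open>
  The triangle relation is invariant under permuting \<open>i, j, k\<close> (up to conjugation and inversion),
  so there is one relation per three-element subset of \<open>[n]\<close>. For \<open>{1, i, j}\<close> with \<open>i < j\<close> it says
  \<open>t\<^sub>j\<^sub>i = t\<^sub>j\<^sub>1 t\<^sub>i\<^sub>1\<inverse> t\<^sub>i\<^sub>j t\<^sub>1\<^sub>j\<inverse> t\<^sub>1\<^sub>i\<close> and so eliminates the generator \<open>t\<^sub>j\<^sub>i\<close>. Substituting this into
  the relation for \<open>{i, j, k}\<close> with \<open>2 \<le> i < j < k\<close> and setting
  \<open>a = t\<^sub>i\<^sub>1 t\<^sub>j\<^sub>1\<inverse> t\<^sub>j\<^sub>k\<close>, \<open>b = t\<^sub>1\<^sub>k\<inverse> t\<^sub>1\<^sub>j t\<^sub>i\<^sub>j\<inverse>\<close>, \<open>c = t\<^sub>i\<^sub>k\<close> turns it into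
  \<open>b\<inverse> a\<inverse> c = c a\<inverse> b\<inverse>\<close>, which is equivalent to the small relation \<open>a b c = c b a\<close>.
\<close>

section \<open>Universal properties\<close>

definition letter_value :: "('b, 'm) monoid_scheme \<Rightarrow> ('a \<Rightarrow> 'b) \<Rightarrow> 'a \<times> bool \<Rightarrow> 'b" where
  "letter_value H f a = (if snd a then f (fst a) else inv\<^bsub>H\<^esub> f (fst a))"

text \<open>Defined on all words, reduced or not, so that inductions can strip letters
  freely.\<close>

definition word_value :: "('b, 'm) monoid_scheme \<Rightarrow> ('a \<Rightarrow> 'b) \<Rightarrow> ('a \<times> bool) list \<Rightarrow> 'b" where
  "word_value H f w = foldr (\<lambda>a y. letter_value H f a \<otimes>\<^bsub>H\<^esub> y) w \<one>\<^bsub>H\<^esub>"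

lemma word_value_simps [simp]:
  "word_value H f [] = \<one>\<^bsub>H\<^esub>"
  "word_value H f (a # w) = letter_value H f a \<otimes>\<^bsub>H\<^esub> word_value H f w"
  by (simp_all add: word_value_def)

lemma free_gen_closed: "x \<in> X \<Longrightarrow> free_gen x \<in> carrier (free_group X)"
  by (simp add: free_group_def free_gen_def)

lemma inv_free_gen: "x \<in> X \<Longrightarrow> inv\<^bsub>free_group X\<^esub> free_gen x = [(x, False)]"
  by (rule group.inv_equality[OF group_free_group])
     (simp_all add: free_group_def free_gen_def inv_letter_def)

context group
begin

text \<open>With associativity, these cancel inverse pairs inside right-nested products, which
  settles the word computations below.\<close>

lemma inv_cancel_left [simp]:
  "\<lbrakk>x \<in> carrier G; y \<in> carrier G\<rbrakk> \<Longrightarrow> x \<otimes> (inv x \<otimes> y) = y"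
  "\<lbrakk>x \<in> carrier G; y \<in> carrier G\<rbrakk> \<Longrightarrow> inv x \<otimes> (x \<otimes> y) = y"
  by (simp_all flip: m_assoc)

lemma letter_value_closed:
  "f \<in> X \<rightarrow> carrier G \<Longrightarrow> fst a \<in> X \<Longrightarrow> letter_value G f a \<in> carrier G"
  by (auto simp: letter_value_def)

lemma word_value_closed:
  "f \<in> X \<rightarrow> carrier G \<Longrightarrow> fst ` set w \<subseteq> X \<Longrightarrow> word_value G f w \<in> carrier G"
  by (induction w) (auto intro!: m_closed simp: letter_value_closed)

text \<open>If \<open>push\<close> deletes the first letter of \<open>w\<close> instead of
  prepending \<open>a\<close>, the values of these two letters are mutually inverse and
  cancel.\<close>

lemma word_value_push:
  assumes "f \<in> X \<rightarrow> carrier G" "fst a \<in> X" "fst ` set w \<subseteq> X"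
  shows "word_value G f (push a w) = letter_value G f a \<otimes> word_value G f w"
proof (cases w)
  case (Cons b v)
  have "letter_value G f a \<otimes> (letter_value G f (inv_letter a) \<otimes> word_value G f v) = word_value G f v"
    using assms Cons word_value_closed[of f X v]
    by (auto simp: letter_value_def inv_letter_def Pi_iff)
  with Cons show ?thesis by simp
qed simp

lemma word_value_foldr_push:
  assumes "f \<in> X \<rightarrow> carrier G" "fst ` set u \<subseteq> X" "fst ` set w \<subseteq> X"
  shows "word_value G f (foldr push u w) = word_value G f u \<otimes> word_value G f w"
  using assms(2)
proof (induction u)
  case Nil
  show ?case using assms by (simp add: word_value_closed[of f X])
next
  case (Cons a u)
  have "fst ` set (foldr push u w) \<subseteq> X"
    using set_foldr_push[of u w] Cons.prems assms(3) by fastforce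
  then show ?case
    using Cons assms word_value_closed[of f X] letter_value_closed[of f X a]
    by (simp add: word_value_push[of f X] m_assoc)
qed

text \<open>Existence half of the universal property; the homomorphism is evaluation of
  words.\<close>

lemma free_group_lift:
  assumes f: "f \<in> X \<rightarrow> carrier G"
  obtains h where "h \<in> hom (free_group X) G" "\<And>x. x \<in> X \<Longrightarrow> h (free_gen x) = f x"
proof
  show "word_value G f \<in> hom (free_group X) G"
    using f by (auto simp: hom_def free_group_def word_value_closed word_value_foldr_push)
  show "word_value G f (free_gen x) = f x" if "x \<in> X" for x
    using that f by (simp add: free_gen_def letter_value_def Pi_iff)
qed

text \<open>Uniqueness half: splitting off one letter at a time shows that the values on the
  generators determine \<open>h\<close>.\<close>

lemma free_group_hom_eq:
  assumes h: "h \<in> hom (free_group X) G" and w: "w \<in> carrier (free_group X)"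
  shows "h w = word_value G (\<lambda>x. h (free_gen x)) w"
  using w
proof (induction w)
  interpret F: group "free_group X" by (rule group_free_group)
  interpret h: group_hom "free_group X" G h
    using h by unfold_locales
  {
    case Nil
    show ?case using h.hom_one by (simp add: free_group_def)
  next
    case (Cons a w)
    have w: "w \<in> carrier (free_group X)" and a: "fst a \<in> X" "[a] \<in> carrier (free_group X)"
      using Cons.prems by (auto simp: free_group_def dest: reduced_ConsD)
    \<comment> \<open>Since \<open>a # w\<close> is reduced, multiplying \<open>w\<close> by
      \<open>[a]\<close> cancels nothing.\<close>
    have "a # w = [a] \<otimes>\<^bsub>free_group X\<^esub> w"
      using Cons.prems by (cases w) (auto simp: free_group_def)
    then have "h (a # w) = h [a] \<otimes> h w"
      using a w by simp
    also have "h [a] = letter_value G (\<lambda>x. h (free_gen x)) a"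
    proof (cases a)
      case (Pair x b)
      with a show ?thesis
        using h.hom_inv[OF free_gen_closed[of x X]]
        by (cases b) (auto simp: letter_value_def inv_free_gen simp flip: free_gen_def)
    qed
    finally show ?case using Cons.IH[OF w] by simp
  }
qed

end

section \<open>Normal closures and presented groups\<close>

lemma normal_normal_closure:
  assumes G: "group G" and S: "S \<subseteq> carrier G"
  shows "normal_closure G S \<lhd> G"
proof -
  interpret group G by (rule G)
  let ?A = "{N. N \<lhd> G \<and> S \<subseteq> N}"
  \<comment> \<open>The family must be nonempty, since an empty intersection would be the whole type
    and not a subset of \<open>carrier G\<close>.\<close>
  have ne: "carrier G \<in> ?A"
    using S by (auto intro!: normalI subgroup_self simp: normal_inv_iff)
  have "subgroup (\<Inter>?A) G"
    using ne by (intro subgroups_Inter) (auto intro: normal_imp_subgroup)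
  then show ?thesis
    unfolding normal_closure_def normal_inv_iff
    by (auto simp: normal_inv_iff)
qed

text \<open>The condition puts the relators into the free group, so that their normal closure is a
  normal subgroup and the quotient is a group.\<close>

locale presentation =
  fixes X :: "'a set" and E :: "(('a \<times> bool) list \<times> ('a \<times> bool) list) set"
  assumes rels_closed: "E \<subseteq> carrier (free_group X) \<times> carrier (free_group X)"
begin

sublocale F: group "free_group X"
  by (rule group_free_group)

sublocale N: normal "relator_subgroup X E" "free_group X"
  unfolding relator_subgroup_def
  using rels_closed by (intro normal_normal_closure group_free_group) auto

sublocale P: group "presented_group X E"
  unfolding presented_group_def by (rule N.factorgroup_is_group)

definition proj :: "('a \<times> bool) list \<Rightarrow> ('a \<times> bool) list set" where
  "proj w = relator_subgroup X E #>\<^bsub>free_group X\<^esub> w"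

lemma proj_hom: "proj \<in> hom (free_group X) (presented_group X E)"
  unfolding proj_def presented_group_def by (rule N.r_coset_hom_Mod)

sublocale proj: group_hom "free_group X" "presented_group X E" proj
  by unfold_locales (rule proj_hom)

lemma proj_free_gen: "proj (free_gen x) = presented_gen X E x"
  by (simp add: proj_def presented_gen_def)

lemma presented_gen_closed: "x \<in> X \<Longrightarrow> presented_gen X E x \<in> carrier (presented_group X E)"
  using proj.hom_closed[OF free_gen_closed] by (simp add: proj_free_gen)

lemma proj_surj: "carrier (presented_group X E) = proj ` carrier (free_group X)"
  by (auto simp: presented_group_def FactGroup_def RCOSETS_def proj_def)

lemma proj_rel:
  assumes "(u, v) \<in> E"
  shows "proj u = proj v"
proof -
  have uv: "u \<in> carrier (free_group X)" "v \<in> carrier (free_group X)"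
    using assms rels_closed by auto
  have r: "u \<otimes>\<^bsub>free_group X\<^esub> inv\<^bsub>free_group X\<^esub> v \<in> relator_subgroup X E"
    using assms by (auto simp: relator_subgroup_def normal_closure_def)
  have "proj u \<otimes>\<^bsub>presented_group X E\<^esub> inv\<^bsub>presented_group X E\<^esub> proj v
      = proj (u \<otimes>\<^bsub>free_group X\<^esub> inv\<^bsub>free_group X\<^esub> v)"
    using uv by simp
  also have "\<dots> = \<one>\<^bsub>presented_group X E\<^esub>"
    using F.coset_join2[OF _ N.subgroup_axioms r] uv by (simp add: proj_def presented_group_def)
  finally show ?thesis
    using uv by (metis P.inv_equality P.inv_inv proj.hom_closed P.inv_closed)
qed

text \<open>Von Dyck's theorem: the kernel of the lift to the free group is normal and contains all
  relators, hence their normal closure. Quantifying over every extension \<open>h\<close> of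
  \<open>f\<close> lets relations be checked by homomorphism laws alone.\<close>

lemma presented_group_lift:
  assumes H: "group H" and f: "f \<in> X \<rightarrow> carrier H"
    and rels: "\<And>h u v. \<lbrakk>group_hom (free_group X) H h; \<And>x. x \<in> X \<Longrightarrow> h (free_gen x) = f x;
      (u, v) \<in> E\<rbrakk> \<Longrightarrow> h u = h v"
  obtains \<phi> where "\<phi> \<in> hom (presented_group X E) H"
    "\<And>x. x \<in> X \<Longrightarrow> \<phi> (presented_gen X E x) = f x"
proof -
  obtain h where h: "h \<in> hom (free_group X) H" and hf: "\<And>x. x \<in> X \<Longrightarrow> h (free_gen x) = f x"
    using group.free_group_lift[OF H f] by blast
  interpret h: group_hom "free_group X" H h
    using H h by (intro group_hom.intro F.is_group group_hom_axioms.intro)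
  have "u \<otimes>\<^bsub>free_group X\<^esub> inv\<^bsub>free_group X\<^esub> v \<in> kernel (free_group X) H h" if "(u, v) \<in> E" for u v
    using that rels_closed rels[OF h.group_hom_axioms hf that] by (auto simp: kernel_def)
  then have "relator_subgroup X E \<subseteq> kernel (free_group X) H h"
    using h.normal_kernel by (auto simp: relator_subgroup_def normal_closure_def)
  then obtain g where g: "g \<in> hom (presented_group X E) H"
    "\<And>w. w \<in> carrier (free_group X) \<Longrightarrow> g (proj w) = h w"
    using h.FactGroup_universal_kernel[OF N.normal_axioms] unfolding presented_group_def proj_def by metis
  show thesis
    using that[OF g(1)] g(2) hf by (simp add: free_gen_closed flip: proj_free_gen)
qed

text \<open>Every element is the image of a word, and a homomorphism evaluates that word at the
  images of the generators. This later reduces identities between homomorphisms to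
  generators.\<close>

lemma presented_group_hom_unique:
  assumes H: "group H" and \<phi>: "\<phi> \<in> hom (presented_group X E) H" and \<psi>: "\<psi> \<in> hom (presented_group X E) H"
    and eq: "\<And>x. x \<in> X \<Longrightarrow> \<phi> (presented_gen X E x) = \<psi> (presented_gen X E x)"
    and y: "y \<in> carrier (presented_group X E)"
  shows "\<phi> y = \<psi> y"
proof -
  obtain w where w: "w \<in> carrier (free_group X)" "y = proj w"
    using y proj_surj by auto
  have eval: "\<theta> y = word_value H (\<lambda>x. \<theta> (presented_gen X E x)) w"
    if "\<theta> \<in> hom (presented_group X E) H" for \<theta>
    using group.free_group_hom_eq[OF H Group.hom_compose[OF proj_hom that] w(1)]
    by (simp add: w(2) proj_free_gen)
  have "word_value H (\<lambda>x. \<phi> (presented_gen X E x)) v = word_value H (\<lambda>x. \<psi> (presented_gen X E x)) v"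
    if "fst ` set v \<subseteq> X" for v
    using that by (induction v) (auto simp: letter_value_def eq)
  then show ?thesis
    using w(1) unfolding eval[OF \<phi>] eval[OF \<psi>] by (simp add: free_group_def)
qed

end

section \<open>Triangle relations in a group\<close>

context group
begin

text \<open>The family \<open>f\<close> is arbitrary, so the predicate serves both for the
  generators of the big triangle group and for their intended images in the small one.\<close>

definition triangle :: "(nat \<times> nat \<Rightarrow> 'a) \<Rightarrow> nat \<Rightarrow> nat \<Rightarrow> nat \<Rightarrow> bool" where
  "triangle f i j k \<longleftrightarrow>
     f (i, j) \<otimes> inv f (k, j) \<otimes> f (k, i) = f (i, k) \<otimes> inv f (j, k) \<otimes> f (j, i)"

text \<open>Exchanging \<open>j\<close> and \<open>k\<close> exchanges the two sides of the
  equation.\<close>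

lemma triangle_swap23: "triangle f i j k \<Longrightarrow> triangle f i k j"
  by (simp add: triangle_def)

text \<open>Invert both sides, then multiply by \<open>f (j, i)\<close> on the left and
  \<open>f (i, j)\<close> on the right; one outer factor cancels on each side.\<close>

lemma triangle_swap12:
  assumes "triangle f i j k"
    and "f (i, j) \<in> carrier G" "f (i, k) \<in> carrier G" "f (j, i) \<in> carrier G"
      "f (j, k) \<in> carrier G" "f (k, i) \<in> carrier G" "f (k, j) \<in> carrier G"
  shows "triangle f j i k"
proof -
  have "inv (f (i, j) \<otimes> inv f (k, j) \<otimes> f (k, i)) = inv (f (i, k) \<otimes> inv f (j, k) \<otimes> f (j, i))"
    using assms(1) by (simp add: triangle_def)
  then have "f (j, i) \<otimes> inv (f (i, j) \<otimes> inv f (k, j) \<otimes> f (k, i)) \<otimes> f (i, j)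
      = f (j, i) \<otimes> inv (f (i, k) \<otimes> inv f (j, k) \<otimes> f (j, i)) \<otimes> f (i, j)"
    by simp
  with assms(2-) show ?thesis
    by (simp add: triangle_def inv_mult_group m_assoc)
qed

lemma eq_solve_middle:
  assumes "a \<in> carrier G" "b \<in> carrier G" "c \<in> carrier G" "d \<in> carrier G"
  shows "a \<otimes> inv b \<otimes> c = d \<longleftrightarrow> b = c \<otimes> inv d \<otimes> a"
proof
  assume "a \<otimes> inv b \<otimes> c = d"
  then show "b = c \<otimes> inv d \<otimes> a"
    using assms by (auto simp: inv_mult_group m_assoc)
next
  assume "b = c \<otimes> inv d \<otimes> a"
  then show "a \<otimes> inv b \<otimes> c = d"
    using assms by (auto simp: inv_mult_group m_assoc)
qed

text \<open>\<open>f (j, i)\<close> occurs only once, inverted in the middle of the left side, so it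
  can be isolated. No order between \<open>i\<close> and \<open>j\<close> is assumed.\<close>

lemma triangle_solve:
  assumes "f (1, i) \<in> carrier G" "f (1, j) \<in> carrier G" "f (i, 1) \<in> carrier G"
      "f (i, j) \<in> carrier G" "f (j, 1) \<in> carrier G" "f (j, i) \<in> carrier G"
  shows "triangle f 1 i j \<longleftrightarrow>
    f (j, i) = f (j, 1) \<otimes> inv f (i, 1) \<otimes> f (i, j) \<otimes> inv f (1, j) \<otimes> f (1, i)"
  unfolding triangle_def using assms
  by (subst eq_solve_middle) (auto simp: inv_mult_group m_assoc)

text \<open>Multiplying the first equation by \<open>a b\<close> on the left and \<open>b a\<close>
  on the right gives the second with its sides exchanged; the inverse multiplication leads
  back.\<close>

lemma reversal_inv_iff:
  assumes "a \<in> carrier G" "b \<in> carrier G" "c \<in> carrier G"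
  shows "inv b \<otimes> inv a \<otimes> c = c \<otimes> inv a \<otimes> inv b \<longleftrightarrow> a \<otimes> b \<otimes> c = c \<otimes> b \<otimes> a"
proof
  assume "inv b \<otimes> inv a \<otimes> c = c \<otimes> inv a \<otimes> inv b"
  then have "a \<otimes> b \<otimes> (inv b \<otimes> inv a \<otimes> c) \<otimes> b \<otimes> a = a \<otimes> b \<otimes> (c \<otimes> inv a \<otimes> inv b) \<otimes> b \<otimes> a"
    by simp
  then show "a \<otimes> b \<otimes> c = c \<otimes> b \<otimes> a"
    using assms by (simp add: m_assoc)
next
  assume "a \<otimes> b \<otimes> c = c \<otimes> b \<otimes> a"
  then have "inv b \<otimes> inv a \<otimes> (a \<otimes> b \<otimes> c) \<otimes> inv a \<otimes> inv b = inv b \<otimes> inv a \<otimes> (c \<otimes> b \<otimes> a) \<otimes> inv a \<otimes> inv b"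
    by simp
  then show "inv b \<otimes> inv a \<otimes> c = c \<otimes> inv a \<otimes> inv b"
    using assms by (simp add: m_assoc)
qed

lemma triangle_iff_small_rel:
  assumes f: "\<And>p q. p \<in> {1, i, j, k} \<Longrightarrow> q \<in> {1, i, j, k} \<Longrightarrow> p \<noteq> q \<Longrightarrow> f (p, q) \<in> carrier G"
    and distinct: "distinct [1, i, j, k]"
    and tri: "triangle f 1 i j" "triangle f 1 i k" "triangle f 1 j k"
  shows "triangle f i j k \<longleftrightarrow>
    f (i, 1) \<otimes> inv f (j, 1) \<otimes> f (j, k) \<otimes> inv f (1, k) \<otimes> f (1, j) \<otimes> inv f (i, j) \<otimes> f (i, k)
    = f (i, k) \<otimes> inv f (1, k) \<otimes> f (1, j) \<otimes> inv f (i, j) \<otimes> f (i, 1) \<otimes> inv f (j, 1) \<otimes> f (j, k)"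
proof -
  have c [simp]: "f (i, 1) \<in> carrier G" "f (j, 1) \<in> carrier G" "f (k, 1) \<in> carrier G"
    "f (1, i) \<in> carrier G" "f (1, j) \<in> carrier G" "f (1, k) \<in> carrier G"
    "f (i, j) \<in> carrier G" "f (i, k) \<in> carrier G" "f (j, k) \<in> carrier G"
    "f (j, i) \<in> carrier G" "f (k, i) \<in> carrier G" "f (k, j) \<in> carrier G"
    using f distinct by auto
  define a where "a = f (i, 1) \<otimes> inv f (j, 1) \<otimes> f (j, k)"
  define b where "b = inv f (1, k) \<otimes> f (1, j) \<otimes> inv f (i, j)"
  have ab [simp]: "a \<in> carrier G" "b \<in> carrier G"
    by (simp_all add: a_def b_def del: One_nat_def)
  have L: "f (i, j) \<otimes> inv f (k, j) \<otimes> f (k, i)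
      = inv b \<otimes> inv a \<otimes> f (i, k) \<otimes> (inv f (1, k) \<otimes> f (1, i))"
    using triangle_solve[of f i k] triangle_solve[of f j k] tri
    by (simp add: a_def b_def inv_mult_group m_assoc del: One_nat_def)
  \<comment> \<open>Inserting \<open>f (1, k)\<close> and its inverse produces \<open>inv b\<close>
    and the same right factor as in \<open>L\<close>, which can then be cancelled.\<close>
  have R: "f (i, k) \<otimes> inv f (j, k) \<otimes> f (j, i)
      = f (i, k) \<otimes> inv a \<otimes> inv b \<otimes> (inv f (1, k) \<otimes> f (1, i))"
    using triangle_solve[of f i j] tri
    by (simp add: a_def b_def inv_mult_group m_assoc del: One_nat_def)
  have "triangle f i j k \<longleftrightarrow> inv b \<otimes> inv a \<otimes> f (i, k) = f (i, k) \<otimes> inv a \<otimes> inv b"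
    unfolding triangle_def L R by (simp del: One_nat_def)
  also have "\<dots> \<longleftrightarrow> a \<otimes> b \<otimes> f (i, k) = f (i, k) \<otimes> b \<otimes> a"
    by (rule reversal_inv_iff) simp_all
  finally show ?thesis
    by (simp add: a_def b_def m_assoc del: One_nat_def)
qed

text \<open>The two swaps generate all permutations of three indices, so one ordering per
  three-element subset suffices.\<close>

lemma triangle_of_sorted:
  assumes f: "\<And>p q. p \<in> S \<Longrightarrow> q \<in> S \<Longrightarrow> p \<noteq> q \<Longrightarrow> f (p, q) \<in> carrier G"
    and sorted: "\<And>i j k. \<lbrakk>i \<in> S; j \<in> S; k \<in> S; i < j; j < k\<rbrakk> \<Longrightarrow> triangle f i j k"
    and S: "i \<in> S" "j \<in> S" "k \<in> S" "i \<noteq> j" "j \<noteq> k" "i \<noteq> k"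
  shows "triangle f i j k"
proof -
  have swap: "triangle f q p r"
    if "triangle f p q r" "p \<in> S" "q \<in> S" "r \<in> S" "p \<noteq> q" "q \<noteq> r" "p \<noteq> r" for p q r
    by (rule triangle_swap12[OF that(1)]; rule f) (use that in auto)
  have pair: "triangle f p q r"
    if "p < q" "p \<in> S" "q \<in> S" "r \<in> S" "q \<noteq> r" "p \<noteq> r" for p q r
  proof -
    consider "q < r" | "p < r" "r < q" | "r < p"
      using \<open>q \<noteq> r\<close> \<open>p \<noteq> r\<close> by linarith
    then show ?thesis
    proof cases
      case 1
      with that show ?thesis by (simp add: sorted)
    next
      case 2
      with that show ?thesis by (simp add: sorted triangle_swap23)
    next
      case 3
      \<comment> \<open>Two swaps lead from the sorted triple \<open>(r, p, q)\<close> through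
        \<open>(p, r, q)\<close> to \<open>(p, q, r)\<close>.\<close>
      with that have "triangle f p r q"
        by (auto intro: swap[OF sorted[of r p q]])
      then show ?thesis by (rule triangle_swap23)
    qed
  qed
  show ?thesis
    using S pair[of i j k] swap[OF pair[of j i k]] by (cases "i < j") auto
qed

end

section \<open>Comparison of the two presentations\<close>

lemma presentation_triangle: "presentation (triangle_gens n) (triangle_rels n)"
proof
  interpret F: group "free_group (triangle_gens n)" by (rule group_free_group)
  show "triangle_rels n \<subseteq> carrier (free_group (triangle_gens n)) \<times> carrier (free_group (triangle_gens n))"
    unfolding triangle_rels_def Let_def
    by (auto intro!: F.m_closed F.inv_closed free_gen_closed) (auto simp: triangle_gens_def)
qed

lemma presentation_small: "presentation (small_gens n) (small_rels n)"
proof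
  interpret F: group "free_group (small_gens n)" by (rule group_free_group)
  show "small_rels n \<subseteq> carrier (free_group (small_gens n)) \<times> carrier (free_group (small_gens n))"
    unfolding small_rels_def Let_def
    by (auto intro!: F.m_closed F.inv_closed free_gen_closed) (auto simp: small_gens_def)
qed

lemma small_gens_subset: "small_gens n \<subseteq> triangle_gens n"
  by (auto simp: small_gens_def triangle_gens_def)

text \<open>Being presented by the given elements means that the map matching generators of the same
  name is an isomorphism; an unspecified isomorphism would say less.\<close>

theorem proposition2p28:
  fixes n :: nat
  assumes "n \<ge> 3"
  shows "\<exists>\<phi> \<in> iso (presented_group (small_gens n) (small_rels n)) (big_triangle_group n).
           \<forall>p \<in> small_gens n.
             \<phi> (presented_gen (small_gens n) (small_rels n) p) = big_triangle_gen n p"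
proof -
  interpret S: presentation "small_gens n" "small_rels n" by (rule presentation_small)
  interpret T: presentation "triangle_gens n" "triangle_rels n" by (rule presentation_triangle)
  define P where "P = presented_group (small_gens n) (small_rels n)"
  define Q where "Q = presented_group (triangle_gens n) (triangle_rels n)"
  define s where "s = presented_gen (small_gens n) (small_rels n)"
  define t where "t = presented_gen (triangle_gens n) (triangle_rels n)"
  have Pg: "group P" and Qg: "group Q"
    unfolding P_def Q_def by (rule S.P.is_group T.P.is_group)+
  interpret P: group P by (rule Pg)
  interpret Q: group Q by (rule Qg)
  have sc: "s p \<in> carrier P" if "p \<in> small_gens n" for p
    using that S.presented_gen_closed by (simp add: s_def P_def)
  have tc: "t (i, j) \<in> carrier Q" if "i \<in> {1..n}" "j \<in> {1..n}" "i \<noteq> j" for i j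
    using that T.presented_gen_closed by (simp add: t_def Q_def triangle_gens_def)

  have Q_tri: "Q.triangle t i j k"
    if ijk: "i \<in> {1..n}" "j \<in> {1..n}" "k \<in> {1..n}" "i \<noteq> j" "j \<noteq> k" "i \<noteq> k" for i j k
  proof -
    let ?g = "\<lambda>i j. free_gen (i, j)" and ?F = "free_group (triangle_gens n)"
    have c: "?g p q \<in> carrier ?F" if "p \<in> {i, j, k}" "q \<in> {i, j, k}" "p \<noteq> q" for p q
      using that ijk by (intro free_gen_closed) (auto simp: triangle_gens_def)
    have "(?g i j \<otimes>\<^bsub>?F\<^esub> inv\<^bsub>?F\<^esub> ?g k j \<otimes>\<^bsub>?F\<^esub> ?g k i, ?g i k \<otimes>\<^bsub>?F\<^esub> inv\<^bsub>?F\<^esub> ?g j k \<otimes>\<^bsub>?F\<^esub> ?g j i)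
        \<in> triangle_rels n"
      unfolding triangle_rels_def Let_def using ijk by blast
    from T.proj_rel[OF this] show ?thesis
      using ijk by (simp add: c Q.triangle_def T.proj_free_gen flip: Q_def t_def)
  qed

  \<comment> \<open>The small relations hold in \<open>Q\<close> because all triangle relations on
    \<open>{1, i, j, k}\<close> do, and three of them turn the fourth into the small
    relation.\<close>
  obtain \<phi> where \<phi>: "\<phi> \<in> hom P Q" and \<phi>s: "\<And>p. p \<in> small_gens n \<Longrightarrow> \<phi> (s p) = t p"
  proof (rule S.presented_group_lift[OF Qg, of t, folded P_def s_def])
    show "t \<in> small_gens n \<rightarrow> carrier Q"
      using tc small_gens_subset[of n] by (force simp: triangle_gens_def)
    fix h u v
    assume h: "group_hom (free_group (small_gens n)) Q h"
      and ht: "\<And>x. x \<in> small_gens n \<Longrightarrow> h (free_gen x) = t x" and uv: "(u, v) \<in> small_rels n"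
    interpret h: group_hom "free_group (small_gens n)" Q h by (rule h)
    let ?g = "\<lambda>i j. free_gen (i, j)" and ?F = "free_group (small_gens n)"
    obtain i j k where ijk: "2 \<le> i" "i < j" "j < k" "k \<le> n"
      and u: "u = ?g i 1 \<otimes>\<^bsub>?F\<^esub> inv\<^bsub>?F\<^esub> ?g j 1 \<otimes>\<^bsub>?F\<^esub> ?g j k \<otimes>\<^bsub>?F\<^esub> inv\<^bsub>?F\<^esub> ?g 1 k \<otimes>\<^bsub>?F\<^esub> ?g 1 j \<otimes>\<^bsub>?F\<^esub> inv\<^bsub>?F\<^esub> ?g i j \<otimes>\<^bsub>?F\<^esub> ?g i k"
      and v: "v = ?g i k \<otimes>\<^bsub>?F\<^esub> inv\<^bsub>?F\<^esub> ?g 1 k \<otimes>\<^bsub>?F\<^esub> ?g 1 j \<otimes>\<^bsub>?F\<^esub> inv\<^bsub>?F\<^esub> ?g i j \<otimes>\<^bsub>?F\<^esub> ?g i 1 \<otimes>\<^bsub>?F\<^esub> inv\<^bsub>?F\<^esub> ?g j 1 \<otimes>\<^bsub>?F\<^esub> ?g j k"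
      using uv unfolding small_rels_def Let_def by blast
    have g: "(i, 1) \<in> small_gens n" "(j, 1) \<in> small_gens n" "(1, j) \<in> small_gens n" "(1, k) \<in> small_gens n"
      "(i, j) \<in> small_gens n" "(i, k) \<in> small_gens n" "(j, k) \<in> small_gens n"
      using ijk by (auto simp: small_gens_def)
    have "Q.triangle t i j k"
      using ijk by (intro Q_tri) auto
    moreover have "Q.triangle t 1 i j" "Q.triangle t 1 i k" "Q.triangle t 1 j k"
      using ijk by (intro Q_tri; auto)+
    moreover have "t (p, q) \<in> carrier Q" if "p \<in> {1, i, j, k}" "q \<in> {1, i, j, k}" "p \<noteq> q" for p q
      using that ijk by (intro tc) auto
    moreover have "distinct [1, i, j, k]" using ijk by auto
    ultimately show "h u = h v"
      using Q.triangle_iff_small_rel[of i j k t]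
      by (simp add: u v g[THEN free_gen_closed] ht g del: One_nat_def)
  qed (rule that)

  \<comment> \<open>Outside \<open>small_gens n\<close> the value is the one forced by the triangle
    relation for \<open>{1, i, j}\<close>, solved for the pair with \<open>i > j\<close>. Values at
    pairs outside \<open>triangle_gens n\<close> are arbitrary.\<close>
  define f where "f = (\<lambda>(i, j). if (i, j) \<in> small_gens n then s (i, j)
    else s (i, 1) \<otimes>\<^bsub>P\<^esub> inv\<^bsub>P\<^esub> s (j, 1) \<otimes>\<^bsub>P\<^esub> s (j, i) \<otimes>\<^bsub>P\<^esub> inv\<^bsub>P\<^esub> s (1, i) \<otimes>\<^bsub>P\<^esub> s (1, j))"
  have f_small: "f p = s p" if "p \<in> small_gens n" for p
    using that by (cases p) (simp add: f_def)
  have f_big: "f (j, i) = s (j, 1) \<otimes>\<^bsub>P\<^esub> inv\<^bsub>P\<^esub> s (i, 1) \<otimes>\<^bsub>P\<^esub> s (i, j) \<otimes>\<^bsub>P\<^esub> inv\<^bsub>P\<^esub> s (1, j) \<otimes>\<^bsub>P\<^esub> s (1, i)"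
    if "2 \<le> i" "i < j" "j \<le> n" for i j
    using that by (simp add: f_def small_gens_def)
  have g: "(i, 1) \<in> small_gens n" "(j, 1) \<in> small_gens n" "(1, i) \<in> small_gens n" "(1, j) \<in> small_gens n"
      "(i, j) \<in> small_gens n" if "2 \<le> i" "i < j" "j \<le> n" for i j
    using that by (auto simp: small_gens_def)
  have big_cases: "(i, j) \<in> small_gens n \<or> 2 \<le> j \<and> j < i \<and> i \<le> n"
    if "(i, j) \<in> triangle_gens n" for i j
    using that by (auto simp: triangle_gens_def small_gens_def)
  have fc: "f (i, j) \<in> carrier P" if "(i, j) \<in> triangle_gens n" for i j
    using big_cases[OF that] g[of j i]
    by (auto simp: f_small f_big sc del: One_nat_def)
  have fc': "f (i, j) \<in> carrier P" if "i \<in> {1..n}" "j \<in> {1..n}" "i \<noteq> j" for i j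
    using that by (intro fc) (auto simp: triangle_gens_def)

  \<comment> \<open>This holds by construction, as \<open>f\<close> was read off from the solved
    relation.\<close>
  have P_tri_1: "P.triangle f 1 i j" if "2 \<le> i" "i < j" "j \<le> n" for i j
    using that g[OF that] by (subst P.triangle_solve) (auto simp: f_big f_small sc simp del: One_nat_def)
  have P_tri: "P.triangle f i j k" if ijk: "i \<in> {1..n}" "j \<in> {1..n}" "k \<in> {1..n}" "i < j" "j < k" for i j k
  proof (cases "i = 1")
    case True
    with ijk show ?thesis using P_tri_1[of j k] by simp
  next
    case False
    then have i: "2 \<le> i" "k \<le> n" using ijk by auto
    let ?g = "\<lambda>i j. free_gen (i, j)" and ?F = "free_group (small_gens n)"
    have gs: "(i, 1) \<in> small_gens n" "(j, 1) \<in> small_gens n" "(1, j) \<in> small_gens n" "(1, k) \<in> small_gens n"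
      "(i, j) \<in> small_gens n" "(i, k) \<in> small_gens n" "(j, k) \<in> small_gens n"
      using i ijk by (auto simp: small_gens_def)
    have "(?g i 1 \<otimes>\<^bsub>?F\<^esub> inv\<^bsub>?F\<^esub> ?g j 1 \<otimes>\<^bsub>?F\<^esub> ?g j k \<otimes>\<^bsub>?F\<^esub> inv\<^bsub>?F\<^esub> ?g 1 k \<otimes>\<^bsub>?F\<^esub> ?g 1 j \<otimes>\<^bsub>?F\<^esub> inv\<^bsub>?F\<^esub> ?g i j \<otimes>\<^bsub>?F\<^esub> ?g i k,
        ?g i k \<otimes>\<^bsub>?F\<^esub> inv\<^bsub>?F\<^esub> ?g 1 k \<otimes>\<^bsub>?F\<^esub> ?g 1 j \<otimes>\<^bsub>?F\<^esub> inv\<^bsub>?F\<^esub> ?g i j \<otimes>\<^bsub>?F\<^esub> ?g i 1 \<otimes>\<^bsub>?F\<^esub> inv\<^bsub>?F\<^esub> ?g j 1 \<otimes>\<^bsub>?F\<^esub> ?g j k)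
        \<in> small_rels n"
      unfolding small_rels_def Let_def using i ijk by blast
    note rel = S.proj_rel[OF this]
    \<comment> \<open>The relations through \<open>1\<close> hold by \<open>P_tri_1\<close>, so the
      equivalence used for \<open>Q\<close> now turns the small relation back into the triangle
      relation.\<close>
    show ?thesis
    proof (subst P.triangle_iff_small_rel)
      show "f (p, q) \<in> carrier P" if "p \<in> {1, i, j, k}" "q \<in> {1, i, j, k}" "p \<noteq> q" for p q
        using that ijk by (intro fc') auto
      show "distinct [1, i, j, k]" using i ijk by auto
      show "P.triangle f 1 i j" "P.triangle f 1 i k" "P.triangle f 1 j k"
        using i ijk by (auto intro!: P_tri_1 simp del: One_nat_def)
    qed (use rel in \<open>simp add: gs[THEN free_gen_closed] gs f_small S.proj_free_gen
      flip: P_def s_def del: One_nat_def\<close>)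
  qed

  obtain \<psi> where \<psi>: "\<psi> \<in> hom Q P" and \<psi>t: "\<And>p. p \<in> triangle_gens n \<Longrightarrow> \<psi> (t p) = f p"
  proof (rule T.presented_group_lift[OF Pg, of f, folded Q_def t_def])
    show "f \<in> triangle_gens n \<rightarrow> carrier P"
      using fc by auto
    fix h u v
    assume h: "group_hom (free_group (triangle_gens n)) P h"
      and hf: "\<And>x. x \<in> triangle_gens n \<Longrightarrow> h (free_gen x) = f x" and uv: "(u, v) \<in> triangle_rels n"
    interpret h: group_hom "free_group (triangle_gens n)" P h by (rule h)
    let ?g = "\<lambda>i j. free_gen (i, j)" and ?F = "free_group (triangle_gens n)"
    obtain i j k where ijk: "i \<in> {1..n}" "j \<in> {1..n}" "k \<in> {1..n}" "i \<noteq> j" "j \<noteq> k" "i \<noteq> k"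
      and u: "u = ?g i j \<otimes>\<^bsub>?F\<^esub> inv\<^bsub>?F\<^esub> ?g k j \<otimes>\<^bsub>?F\<^esub> ?g k i"
      and v: "v = ?g i k \<otimes>\<^bsub>?F\<^esub> inv\<^bsub>?F\<^esub> ?g j k \<otimes>\<^bsub>?F\<^esub> ?g j i"
      using uv unfolding triangle_rels_def Let_def by blast
    have gt: "(i, j) \<in> triangle_gens n" "(i, k) \<in> triangle_gens n" "(j, i) \<in> triangle_gens n"
      "(j, k) \<in> triangle_gens n" "(k, i) \<in> triangle_gens n" "(k, j) \<in> triangle_gens n"
      using ijk by (auto simp: triangle_gens_def)
    \<comment> \<open>Only increasing triples were checked in \<open>P\<close>; symmetry supplies
      the other orderings.\<close>
    have "P.triangle f i j k"
      using P.triangle_of_sorted[of "{1..n}" f i j k] ijk fc' P_tri by blast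
    then show "h u = h v"
      by (simp add: u v gt[THEN free_gen_closed] hf gt P.triangle_def)
  qed (rule that)

  interpret \<phi>: group_hom P Q \<phi> by unfold_locales (rule \<phi>)
  have \<psi>\<phi>: "\<psi> (\<phi> x) = x" if "x \<in> carrier P" for x
  proof -
    have "(\<psi> \<circ> \<phi>) x = id x"
    proof (rule S.presented_group_hom_unique[OF Pg, of "\<psi> \<circ> \<phi>" id, folded P_def s_def])
      show "\<psi> \<circ> \<phi> \<in> hom P P" by (rule Group.hom_compose[OF \<phi> \<psi>])
      show "id \<in> hom P P" by (simp add: hom_def)
      show "(\<psi> \<circ> \<phi>) (s p) = id (s p)" if "p \<in> small_gens n" for p
        using that small_gens_subset[of n] by (auto simp: \<phi>s \<psi>t f_small)
    qed fact
    then show ?thesis by simp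
  qed
  have \<phi>\<psi>: "\<phi> (\<psi> y) = y" if "y \<in> carrier Q" for y
  proof -
    have "(\<phi> \<circ> \<psi>) y = id y"
    proof (rule T.presented_group_hom_unique[OF Qg, of "\<phi> \<circ> \<psi>" id, folded Q_def t_def])
      show "\<phi> \<circ> \<psi> \<in> hom Q Q" by (rule Group.hom_compose[OF \<psi> \<phi>])
      show "id \<in> hom Q Q" by (simp add: hom_def)
      show "(\<phi> \<circ> \<psi>) (t p) = id (t p)" if "p \<in> triangle_gens n" for p
      proof (cases p)
        case (Pair j i)
        with that big_cases[of j i] consider "p \<in> small_gens n" | "2 \<le> i" "i < j" "j \<le> n"
          by auto
        then show ?thesis
        proof cases
          case 1
          then show ?thesis using that by (simp add: \<psi>t f_small \<phi>s)
        next
          case 2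
          \<comment> \<open>An eliminated generator: its image \<open>f (j, i)\<close> is sent by
            \<open>\<phi>\<close> to a word in the \<open>t\<close>, which this relation in
            \<open>Q\<close> identifies with \<open>t (j, i)\<close>.\<close>
          have "Q.triangle t 1 i j"
            using 2 by (intro Q_tri) auto
          then have "t (j, i) = t (j, 1) \<otimes>\<^bsub>Q\<^esub> inv\<^bsub>Q\<^esub> t (i, 1) \<otimes>\<^bsub>Q\<^esub> t (i, j) \<otimes>\<^bsub>Q\<^esub> inv\<^bsub>Q\<^esub> t (1, j) \<otimes>\<^bsub>Q\<^esub> t (1, i)"
            using 2 tc by (subst (asm) Q.triangle_solve) auto
          also have "\<dots> = \<phi> (f (j, i))"
            using 2 g[OF 2] by (simp add: f_big \<phi>s sc del: One_nat_def)
          finally have "t p = \<phi> (f p)" by (simp add: Pair)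
          with \<psi>t[OF that] show ?thesis by simp
        qed
      qed
    qed fact
    then show ?thesis by simp
  qed
  have "\<phi> \<in> iso P Q"
    using \<phi> \<psi> \<psi>\<phi> \<phi>\<psi>
    by (intro group_isomorphisms_imp_iso[of P Q \<phi> \<psi>]) (simp add: group_isomorphisms_def)
  with \<phi>s show ?thesis
    unfolding P_def Q_def s_def t_def big_triangle_group_def big_triangle_gen_def by blast
qed

end
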